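(* Let $\mu \in \mathcal{D}$, let $u_\mu \in X$ be the solution of $\mathcal{L}_\mu u_\mu = f_\mu$, let $u_\mu^h \in X^h$ be a discrete approximation of $u_\mu$, and let $e_\mu^h := u_\mu - u_\mu^h$ and $r_\mu^h := f_\mu - \mathcal{L}_\mu u_\mu^h$. Let $\hat e_\mu^h \in Z^h$ be any approximation of $e_\mu^h$ and let $\rho_\mu^h := r_\mu^h - \mathcal{L}_\mu \hat e_\mu^h$. Then $$\|e_\mu^h\|_X \leq \|\hat e_\mu^h\|_X + \frac{\|\rho_\mu^h\|_Y}{\sqrt{\alpha(\mu)}}.$$
   Context: $X$ and $Y$ are (real) Hilbert spaces and $\mathcal{D} \subset \mathbb{R}^P$ ($P \geq 1$) is compact. For every $\mu \in \mathcal{D}$, $\mathcal{L}_\mu : X \to Y$ is a linear operator, $f_\mu \in Y$ is given, and there are constants $0 < \alpha(\mu) \leq \gamma(\mu) < \infty$ such that $$\alpha(\mu)\|v\|_X^2 \leq \|\mathcal{L}_\mu v\|_Y^2 \leq \gamma(\mu)\|v\|_X^2 \quad \text{for all } v \in X.$$ $X^h \subset X$ and $Z^h \subset X$ are finite-dimensional subspaces (no relation between them is assumed). The words "discrete approximation" and "approximation" impose no condition: $u_\mu^h$ is an arbitrary element of $X^h$ and $\hat e_\mu^h$ is an arbitrary element of $Z^h$. *)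

theory Defs
  imports "HOL-Analysis.Analysis"
begin

(* The library constant dim is 0 on a subspace without a finite basis, so a bound on dim would not
   express finite-dimensionality in an infinite-dimensional space. *)
definition finite_dim_subspace :: "'a::real_vector set \<Rightarrow> bool" where
  "finite_dim_subspace S \<longleftrightarrow> subspace S \<and> (\<exists>B. finite B \<and> span B = S)"

end

theory Submission
  imports Defs
begin

text \<open>The residual \<open>\<rho>\<close> is the image under \<open>L \<mu>\<close> of the part
  \<open>e - eh\<close> of the error that \<open>eh\<close> misses. The lower bound with constant
  \<open>\<alpha> \<mu>\<close> makes \<open>L \<mu>\<close> stably invertible on its range, so the
  norm of \<open>e - eh\<close> is at most that of \<open>\<rho>\<close> divided by
  \<open>sqrt (\<alpha> \<mu>)\<close>. The triangle inequality \<open>norm_triangle_sub\<close> for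
  \<open>e = eh + (e - eh)\<close> then gives the claim.\<close>

theorem mainTheorem2:
  fixes D :: "(real ^ 'p) set"
    and L :: "real ^ 'p \<Rightarrow> 'x::{real_inner, complete_space} \<Rightarrow> 'y::{real_inner, complete_space}"
    and f :: "real ^ 'p \<Rightarrow> 'y"
    and \<alpha> \<gamma> :: "real ^ 'p \<Rightarrow> real"
    and Xh Zh :: "'x set"
    and \<mu> :: "real ^ 'p"
    and u uh e eh :: 'x
    and r \<rho> :: 'y
  assumes "compact D"
    and "\<And>\<nu>. \<nu> \<in> D \<Longrightarrow> linear (L \<nu>)"
    and "\<And>\<nu>. \<nu> \<in> D \<Longrightarrow> 0 < \<alpha> \<nu> \<and> \<alpha> \<nu> \<le> \<gamma> \<nu>"
    and "\<And>\<nu> v. \<nu> \<in> D \<Longrightarrow>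
           \<alpha> \<nu> * (norm v)\<^sup>2 \<le> (norm (L \<nu> v))\<^sup>2 \<and>
           (norm (L \<nu> v))\<^sup>2 \<le> \<gamma> \<nu> * (norm v)\<^sup>2"
    and "finite_dim_subspace Xh"
    and "finite_dim_subspace Zh"
    and "\<mu> \<in> D"
    and "L \<mu> u = f \<mu>"
    and "uh \<in> Xh"
    and "e = u - uh"
    and "r = f \<mu> - L \<mu> uh"
    and "eh \<in> Zh"
    and "\<rho> = r - L \<mu> eh"
  shows "norm e \<le> norm eh + norm \<rho> / sqrt (\<alpha> \<mu>)"
proof -
  have lin: "linear (L \<mu>)" and pos: "0 < \<alpha> \<mu>"
    using assms(2,3,7) by auto
  \<comment> \<open>As \<open>f \<mu>\<close> is \<open>L \<mu> u\<close>, linearity turns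
    \<open>r\<close> into \<open>L \<mu> e\<close>.\<close>
  have \<rho>: "\<rho> = L \<mu> (e - eh)"
    using assms(8,10,11,13) by (simp add: linear_diff[OF lin])
  \<comment> \<open>The lower stability bound at \<open>v = e - eh\<close>, under a root because
    that bound is stated for squared norms.\<close>
  have "sqrt (\<alpha> \<mu> * (norm (e - eh))\<^sup>2) \<le> sqrt ((norm \<rho>)\<^sup>2)"
    using assms(4,7) unfolding \<rho> by (intro real_sqrt_le_mono) blast
  then have "norm (e - eh) \<le> norm \<rho> / sqrt (\<alpha> \<mu>)"
    using pos by (simp add: real_sqrt_mult pos_le_divide_eq mult.commute)
  with norm_triangle_sub[of e eh] show ?thesis
    by linarith
qed

end
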